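(* Let the target $p(\theta\mid y)$, $\theta\in\mathbb{R}$, be the log transformed inverse gamma density, i.e. $\exp(-\theta)\mid y\sim\mathrm{Gamma}(a_1,b_1)$ (shape $a_1$, rate $b_1$) with $a_1=a_0+n/2$, $b_1=b_0+\frac12\sum_{i=1}^n y_i^2$, $a_0=b_0=0.01$, $n\ge 1$ and $y_1,\dots,y_n\in\mathbb{R}$. Let the variational approximation be $q(\theta)=\mathrm{N}(\mu,\sigma^2)$, $\mu\in\mathbb{R}$, $\sigma^2>0$. Let $(\hat\mu_{\mathrm{KL}},\hat\sigma^2_{\mathrm{KL}})$, $(\hat\mu_{\mathrm F},\hat\sigma^2_{\mathrm F})$ and $(\hat\mu_{\mathrm S},\hat\sigma^2_{\mathrm S})$ denote the optimal mean and variance parameters $(\mu,\sigma^2)$ that minimize the Kullback-Leibler divergence $\mathrm{KL}(q\|p)$, the Fisher divergence $F(q\|p)$ and the score-based divergence $S(q\|p)$, respectively. Then $$\hat\sigma^2_{\mathrm S}<\hat\sigma^2_{\mathrm F}<\hat\sigma^2_{\mathrm{KL}}<\sigma_*^2,$$ $$m_*<\hat\mu_{\mathrm S}<\hat\mu_{\mathrm F}<\hat\mu_{\mathrm{KL}}<\mu_*,$$ where $\mu_*$, $m_*$ and $\sigma_*^2$ denote the mean, mode and variance of the target.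
   Context: The setting is the model $y_i\mid\theta\sim\mathrm{N}(0,\exp(\theta))$ for $i=1,\dots,n$ with prior $\exp(\theta)\sim\mathrm{IG}(a_0,b_0)$ (inverse gamma). The target density in $\theta$ satisfies $p(\theta\mid y)\propto\exp\{-a_1\theta-b_1e^{-\theta}\}$; its mode is $m_*=\log(b_1/a_1)$, its mean is $\mu_*=\log b_1-\psi(a_1)$ and its variance is $\sigma_*^2=\psi_1(a_1)$, where $\psi$ and $\psi_1$ are the digamma and trigamma functions. The divergences are $\mathrm{KL}(q\|p)=\int q\log\frac{q(\theta)}{p(\theta|y)}d\theta$, $F(q\|p)=\int q(\theta)\{\frac{d}{d\theta}\log q(\theta)-\frac{d}{d\theta}\log p(\theta|y)\}^2d\theta$, and $S(q\|p)=\sigma^2F(q\|p)$.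
   Formalization: For n = 1 the Fisher divergence F(q||p) has no global minimizer (its infimum is approached only as the variance tends to infinity), so there the optimal parameters are taken to be its local minimizer; in all other cases "minimize" means global minimization. *)

theory Defs
  imports "HOL-Probability.Probability"
begin

definition gamma_density :: "real \<Rightarrow> real \<Rightarrow> real \<Rightarrow> real" where
  "gamma_density a b x =
     (if x > 0 then b powr a / Gamma a * x powr (a - 1) * exp (- b * x) else 0)"

(* Density of \<theta> when exp (- \<theta>) has the Gamma(a, b) distribution (shape a, rate b); the
   trailing factor is the Jacobian of \<theta> \<mapsto> exp (- \<theta>). *)
definition log_inv_gamma_density :: "real \<Rightarrow> real \<Rightarrow> real \<Rightarrow> real" where
  "log_inv_gamma_density a b \<theta> = gamma_density a b (exp (- \<theta>)) * exp (- \<theta>)"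

lemma log_inv_gamma_density_eq:
  "log_inv_gamma_density a b \<theta> = b powr a / Gamma a * exp (- a * \<theta> - b * exp (- \<theta>))"
proof -
  have "exp (- \<theta>) powr (a - 1) * exp (- b * exp (- \<theta>)) * exp (- \<theta>)
      = exp (- \<theta> * (a - 1) + - b * exp (- \<theta>) + - \<theta>)"
    by (simp only: powr_def exp_add) (simp add: mult.commute)
  also have "\<dots> = exp (- a * \<theta> - b * exp (- \<theta>))"
    by (rule arg_cong[where f = exp]) (simp add: algebra_simps)
  finally show ?thesis
    by (simp add: log_inv_gamma_density_def gamma_density_def mult.assoc)
qed

definition mean_of :: "(real \<Rightarrow> real) \<Rightarrow> real" where
  "mean_of p = (\<integral>\<theta>. \<theta> \<partial>density lborel p)"

definition variance_of :: "(real \<Rightarrow> real) \<Rightarrow> real" where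
  "variance_of p = (\<integral>\<theta>. (\<theta> - mean_of p)\<^sup>2 \<partial>density lborel p)"

definition KL :: "(real \<Rightarrow> real) \<Rightarrow> (real \<Rightarrow> real) \<Rightarrow> real" where
  "KL q p = (\<integral>\<theta>. q \<theta> * ln (q \<theta> / p \<theta>) \<partial>lborel)"

(* The library's KL_divergence takes the reference measure first. *)
lemma KL_eq_KL_divergence:
  assumes "p \<in> borel_measurable borel" "q \<in> borel_measurable borel"
    and "\<And>\<theta>. p \<theta> > 0" "\<And>\<theta>. q \<theta> \<ge> 0"
  shows "KL q p = KL_divergence (exp 1) (density lborel p) (density lborel q)"
proof -
  have "KL_divergence (exp 1) (density lborel p) (density lborel q)
      = (\<integral>x. q x * log (exp 1) (q x / p x) \<partial>lborel)"
    using assms(3) order_less_imp_le[OF assms(3)] assms(4)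
    by (intro lborel.KL_density_density) (auto simp: assms less_imp_neq[symmetric])
  then show ?thesis by (simp add: KL_def log_def)
qed

definition Fisher :: "(real \<Rightarrow> real) \<Rightarrow> (real \<Rightarrow> real) \<Rightarrow> real" where
  "Fisher q p =
     (\<integral>\<theta>. q \<theta> * (deriv (\<lambda>t. ln (q t)) \<theta> - deriv (\<lambda>t. ln (p t)) \<theta>)\<^sup>2 \<partial>lborel)"

(* A Gaussian is given by the pair (mean, variance), whereas normal_density takes the
   standard deviation. *)
definition gaussian :: "real \<times> real \<Rightarrow> real \<Rightarrow> real" where
  "gaussian = (\<lambda>(\<mu>, v). normal_density \<mu> (sqrt v))"

definition KL_obj :: "(real \<Rightarrow> real) \<Rightarrow> real \<times> real \<Rightarrow> real" where
  "KL_obj p x = KL (gaussian x) p"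

definition Fisher_obj :: "(real \<Rightarrow> real) \<Rightarrow> real \<times> real \<Rightarrow> real" where
  "Fisher_obj p x = Fisher (gaussian x) p"

definition Score_obj :: "(real \<Rightarrow> real) \<Rightarrow> real \<times> real \<Rightarrow> real" where
  "Score_obj p x = snd x * Fisher (gaussian x) p"

definition is_local_arg_min ::
    "('a::topological_space \<Rightarrow> real) \<Rightarrow> ('a \<Rightarrow> bool) \<Rightarrow> 'a \<Rightarrow> bool" where
  "is_local_arg_min f P x \<longleftrightarrow> P x \<and> (\<forall>\<^sub>F y in at x within Collect P. f x \<le> f y)"

(* The optimal parameters of an objective on the half-plane v > 0: its global minimiser, or,
   only if no global minimiser exists, a local one. The second case is not idle: for the
   log inverse gamma target with shape a, minimising the Fisher objective over \<mu> leaves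
   1 / v + a^2 - (a + 1)^2 * exp (- v), and for small a, such as a = 0.51, this has a unique
   local minimum while its infimum a^2 is only approached as v tends to infinity. *)
definition optimal_params :: "(real \<times> real \<Rightarrow> real) \<Rightarrow> real \<times> real \<Rightarrow> bool" where
  "optimal_params D x \<longleftrightarrow>
     is_arg_min D (\<lambda>(\<mu>, v). v > 0) x \<or>
     (\<nexists>y. is_arg_min D (\<lambda>(\<mu>, v). v > 0) y) \<and> is_local_arg_min D (\<lambda>(\<mu>, v). v > 0) x"

end

theory Submission
  imports Defs "HOL-Real_Asymp.Real_Asymp"
begin

text \<open>
  Each objective is explicit in \<open>(\<mu>, v)\<close>. The Kullback-Leibler optimum is
  \<open>v = 1 / a\<close>, \<open>\<mu> = ln (b / a) + 1 / (2 * a)\<close>. Both other objectives are stationary in \<open>\<mu>\<close>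
  exactly on the curve \<open>\<mu> = ln b - ln (a + 1) + 3 / 2 * v\<close>, and along it every local minimiser satisfies
  \<open>v * (a + 1) = exp (v / 2)\<close> with \<open>v < 2\<close> (Fisher), respectively
  \<open>(1 - v) * exp (- v) = (a / (a + 1))\<^sup>2\<close> (score). What remains between these points are
  one-variable inequalities for \<open>exp\<close>, two of which need \<open>a \<ge> 0.51\<close>.

  The bounds on the target use no polygamma functions. With the score \<open>s = - a + b * exp (- \<theta>)\<close>,
  integration by parts gives \<open>E (\<theta> * s) = - 1\<close>, so the positivity of \<open>E (\<theta> - mean + s / a)\<^sup>2\<close>
  is \<open>variance > 1 / a\<close>. It also gives the recursion \<open>mean (a + 1) = mean a - 1 / a\<close>, which makes
  \<open>mean a - ln (b / a) - 1 / (2 * a)\<close> strictly decreasing along \<open>a, a + 1, a + 2, \<dots>\<close>; its limit is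
  nonnegative by Jensen's inequality.
\<close>

section \<open>Bounds for the exponential function\<close>

text \<open>The Lagrange remainder after the cubic Taylor polynomial is a nonnegative multiple of
  \<open>x ^ 4\<close>.\<close>

lemma exp_lower_cubic:
  fixes x :: real
  assumes "0 \<le> x"
  shows "1 + x + x\<^sup>2 / 2 + x ^ 3 / 6 \<le> exp x"
proof -
  obtain t where "exp x = (\<Sum>m<4. x ^ m / fact m) + exp t / fact 4 * x ^ 4"
    using Maclaurin_exp_le[of x 4] by blast
  moreover have "0 \<le> exp t / fact 4 * x ^ 4" by simp
  ultimately show ?thesis
    by (simp add: numeral_eq_Suc fact_numeral)
qed

text \<open>The Lagrange remainder after the quadratic Taylor polynomial is at most
  \<open>exp x * x ^ 3 / 6\<close>; it is moved to the left-hand side.\<close>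

lemma exp_upper_cubic:
  fixes x :: real
  assumes "0 \<le> x"
  shows "exp x * (1 - x ^ 3 / 6) \<le> 1 + x + x\<^sup>2 / 2"
proof -
  obtain t where t: "\<bar>t\<bar> \<le> \<bar>x\<bar>" "exp x = (\<Sum>m<3. x ^ m / fact m) + exp t / fact 3 * x ^ 3"
    using Maclaurin_exp_le[of x 3] by blast
  have "exp t * x ^ 3 \<le> exp x * x ^ 3"
    using t(1) assms by (intro mult_right_mono) auto
  then show ?thesis
    using t(2) by (simp add: numeral_eq_Suc fact_numeral algebra_simps)
qed

text \<open>Raising the coefficient \<open>1 / 2\<close> to \<open>0.725\<close> leaves a slack of
  \<open>0.225\<close> times the square of \<open>x\<close>, which absorbs the cubic remainder up to
  \<open>0.65\<close>. This range is half of the bound \<open>1.3\<close> proved later for the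
  Fisher variance.\<close>

lemma exp_le_quadratic:
  fixes x :: real
  assumes "0 \<le> x" "x \<le> 0.65"
  shows "exp x \<le> 1 + x + 0.725 * x\<^sup>2"
proof -
  have x2: "x\<^sup>2 \<le> 0.4225"
    using power_mono[OF assms(2,1), of 2] by (simp add: power2_eq_square)
  have x3: "x ^ 3 / 6 < 1"
    using power_mono[OF assms(2,1), of 3] by (simp add: power3_eq_cube)
  have "x * (1 + x + 0.725 * x\<^sup>2) \<le> 0.65 * (1 + 0.65 + 0.725 * 0.4225)"
    using assms x2 by (intro mult_mono) auto
  then have "x * (1 + x + 0.725 * x\<^sup>2) / 6 \<le> 0.225" by simp
  then have "x\<^sup>2 * (x * (1 + x + 0.725 * x\<^sup>2) / 6) \<le> x\<^sup>2 * 0.225"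
    by (intro mult_left_mono) auto
  then have "1 + x + x\<^sup>2 / 2 \<le> (1 + x + 0.725 * x\<^sup>2) * (1 - x ^ 3 / 6)"
    by (simp add: algebra_simps power2_eq_square power3_eq_cube)
  with exp_upper_cubic[OF assms(1)]
  have "exp x * (1 - x ^ 3 / 6) \<le> (1 + x + 0.725 * x\<^sup>2) * (1 - x ^ 3 / 6)" by linarith
  with x3 show ?thesis by simp
qed

text \<open>Convexity of \<open>exp\<close> with denominators cleared, so that numerical estimates
  on an interval reduce to its endpoints.\<close>

lemma exp_le_chord:
  fixes x c y :: real
  assumes "x \<le> c" "c \<le> y" "x < y"
  shows "(y - x) * exp c \<le> (y - c) * exp x + (c - x) * exp y"
proof -
  have "exp c \<le> (exp y - exp x) / (y - x) * (c - x) + exp x"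
    using assms by (intro convex_onD_Icc' convex_on_subset[OF exp_convex]) auto
  then show ?thesis
    using assms by (simp add: field_simps)
qed

text \<open>At \<open>1\<close> itself \<open>exp_upper_cubic\<close> gives only the weak
  inequality, so it is applied at \<open>1/2\<close> and squared: 1.7 * 1.7 = 2.89.\<close>

lemma exp_one_less_3: "exp 1 < (3::real)"
proof -
  have "exp (1/2) * (47/48) \<le> (13/8 :: real)"
    using exp_upper_cubic[of "1/2"] by (simp add: power2_eq_square power3_eq_cube)
  then have "exp (1/2) \<le> (17/10 :: real)" by simp
  then have "exp (1/2) * exp (1/2) \<le> (17/10 * (17/10) :: real)"
    by (intro mult_mono) auto
  then show ?thesis by (simp flip: exp_add)
qed

text \<open>The chord of \<open>exp\<close> over \<open>[0, 1]\<close> has slope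
  \<open>exp 1 - 1 < 2\<close>.\<close>

lemma exp_half_less:
  fixes v :: real
  assumes "0 < v" "v < 2"
  shows "exp (v / 2) < 1 + v"
proof -
  have "exp (v / 2) \<le> (1 - v / 2) + v / 2 * exp 1"
    using exp_le_chord[of 0 "v/2" 1] assms by simp
  moreover have "v / 2 * exp 1 < v / 2 * 3"
    using assms exp_one_less_3 by (intro mult_strict_left_mono) auto
  ultimately show ?thesis by simp
qed

text \<open>The right-hand side is \<open>2 * sinh (ln (1 + x))\<close>. Halving the argument makes
  the inequality strict: \<open>t \<le> sinh t\<close> is weak, but \<open>sinh (2 * t)\<close>
  equals \<open>2 * sinh t * cosh t\<close> with \<open>cosh t > 1\<close>.\<close>

lemma less_ln_half_sum_inverse:
  fixes x :: real
  assumes "0 < x"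
  shows "2 * ln (1 + x) < (1 + x) - inverse (1 + x)"
proof -
  define t where "t = ln (1 + x) / 2"
  have t: "0 < t" using assms by (simp add: t_def)
  have "t \<le> sinh t"
    using real_le_x_sinh[of t] t by (simp add: sinh_field_def exp_minus)
  also have "\<dots> < sinh t * cosh t"
  proof -
    have "cosh 0 < cosh t" using t by (subst cosh_real_nonneg_less_iff) auto
    then show ?thesis using t by simp
  qed
  finally have "2 * t < sinh (2 * t)" by (simp add: sinh_double)
  then show ?thesis
    using sinh_ln_real[of "1 + x"] assms by (simp add: t_def)
qed

section \<open>Closed forms of the objectives\<close>

text \<open>Completing the square: exponential tilting only shifts the mean of a Gaussian.\<close>

lemma exp_mult_normal_density:
  assumes "\<sigma> > 0"
  shows "exp (- k * x) * normal_density \<mu> \<sigma> x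
       = exp (k\<^sup>2 * \<sigma>\<^sup>2 / 2 - k * \<mu>) * normal_density (\<mu> - k * \<sigma>\<^sup>2) \<sigma> x"
proof -
  have "- k * x + - (x - \<mu>)\<^sup>2 / (2 * \<sigma>\<^sup>2)
      = (k\<^sup>2 * \<sigma>\<^sup>2 / 2 - k * \<mu>) + - (x - (\<mu> - k * \<sigma>\<^sup>2))\<^sup>2 / (2 * \<sigma>\<^sup>2)"
    using assms by (simp add: field_simps power2_eq_square)
  then have "exp (- k * x) * exp (- (x - \<mu>)\<^sup>2 / (2 * \<sigma>\<^sup>2))
      = exp (k\<^sup>2 * \<sigma>\<^sup>2 / 2 - k * \<mu>) * exp (- (x - (\<mu> - k * \<sigma>\<^sup>2))\<^sup>2 / (2 * \<sigma>\<^sup>2))"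
    by (simp only: exp_add[symmetric])
  then show ?thesis
    unfolding normal_density_def by (metis mult.left_commute)
qed

lemma gaussian_moments:
  fixes \<mu> v :: real
  assumes v: "v > 0"
  defines "q \<equiv> gaussian (\<mu>, v)"
  shows "has_bochner_integral lborel q 1"
    and "has_bochner_integral lborel (\<lambda>\<theta>. (\<theta> - \<mu>) * q \<theta>) 0"
    and "has_bochner_integral lborel (\<lambda>\<theta>. (\<theta> - \<mu>)\<^sup>2 * q \<theta>) v"
    and "has_bochner_integral lborel (\<lambda>\<theta>. exp (- \<theta>) * q \<theta>) (exp (v / 2 - \<mu>))"
    and "has_bochner_integral lborel (\<lambda>\<theta>. (exp (- \<theta>))\<^sup>2 * q \<theta>) (exp (2 * v - 2 * \<mu>))"
    and "has_bochner_integral lborel (\<lambda>\<theta>. (\<theta> - \<mu>) * (exp (- \<theta>) * q \<theta>)) (- v * exp (v / 2 - \<mu>))"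
proof -
  have s: "sqrt v > 0" using v by simp
  have norm: "has_bochner_integral lborel (normal_density m (sqrt v)) 1" for m
    using normal_moment_even[OF s, of m 0] by simp
  have fst: "has_bochner_integral lborel (\<lambda>\<theta>. (\<theta> - m) * normal_density m (sqrt v) \<theta>) 0" for m
    using normal_moment_odd[OF s, of m 0] by (simp add: mult.commute)
  have q: "q = normal_density \<mu> (sqrt v)" by (simp add: q_def gaussian_def)
  show "has_bochner_integral lborel q 1" unfolding q by (rule norm)
  show "has_bochner_integral lborel (\<lambda>\<theta>. (\<theta> - \<mu>) * q \<theta>) 0" unfolding q by (rule fst)
  show "has_bochner_integral lborel (\<lambda>\<theta>. (\<theta> - \<mu>)\<^sup>2 * q \<theta>) v"
    unfolding q using normal_moment_even[OF s, of \<mu> 1] v by (simp add: mult.commute)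
  have e1: "exp (- \<theta>) * q \<theta> = exp (v / 2 - \<mu>) * normal_density (\<mu> - v) (sqrt v) \<theta>" for \<theta>
    using exp_mult_normal_density[OF s, of 1 \<theta> \<mu>] v by (simp add: q)
  have e2: "(exp (- \<theta>))\<^sup>2 * q \<theta> = exp (2 * v - 2 * \<mu>) * normal_density (\<mu> - 2 * v) (sqrt v) \<theta>" for \<theta>
    using exp_mult_normal_density[OF s, of 2 \<theta> \<mu>] v by (simp add: q flip: exp_double)
  show "has_bochner_integral lborel (\<lambda>\<theta>. exp (- \<theta>) * q \<theta>) (exp (v / 2 - \<mu>))"
    unfolding e1 using has_bochner_integral_mult_right[OF norm, of "exp (v / 2 - \<mu>)"] by simp
  show "has_bochner_integral lborel (\<lambda>\<theta>. (exp (- \<theta>))\<^sup>2 * q \<theta>) (exp (2 * v - 2 * \<mu>))"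
    unfolding e2 using has_bochner_integral_mult_right[OF norm, of "exp (2 * v - 2 * \<mu>)"] by simp
  \<comment> \<open>Under the tilted density, centred at \<open>\<mu> - v\<close>, the factor
    \<open>\<theta> - \<mu>\<close> is a centred variable minus \<open>v\<close>.\<close>
  have "has_bochner_integral lborel
      (\<lambda>\<theta>. exp (v / 2 - \<mu>) * ((\<theta> - (\<mu> - v)) * normal_density (\<mu> - v) (sqrt v) \<theta>
          - v * normal_density (\<mu> - v) (sqrt v) \<theta>)) (exp (v / 2 - \<mu>) * (0 - v * 1))"
    by (intro has_bochner_integral_diff has_bochner_integral_mult_right fst norm)
  also have "(\<lambda>\<theta>. exp (v / 2 - \<mu>) * ((\<theta> - (\<mu> - v)) * normal_density (\<mu> - v) (sqrt v) \<theta>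
          - v * normal_density (\<mu> - v) (sqrt v) \<theta>)) = (\<lambda>\<theta>. (\<theta> - \<mu>) * (exp (- \<theta>) * q \<theta>))"
    unfolding e1 by (rule ext) (simp add: algebra_simps)
  finally show "has_bochner_integral lborel (\<lambda>\<theta>. (\<theta> - \<mu>) * (exp (- \<theta>) * q \<theta>)) (- v * exp (v / 2 - \<mu>))"
    by (simp add: mult.commute)
qed

lemma ln_gaussian:
  assumes "v > 0"
  shows "ln (gaussian (\<mu>, v) \<theta>) = - ln (2 * pi * v) / 2 - (\<theta> - \<mu>)\<^sup>2 / (2 * v)"
  using assms by (simp add: gaussian_def normal_density_def ln_mult ln_div ln_sqrt field_simps)

lemma ln_log_inv_gamma_density:
  assumes "a > 0" "b > 0"
  shows "ln (log_inv_gamma_density a b \<theta>) = ln (b powr a / Gamma a) - a * \<theta> - b * exp (- \<theta>)"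
proof -
  have "b powr a / Gamma a > 0" using assms by (simp add: Gamma_real_pos)
  then show ?thesis unfolding log_inv_gamma_density_eq by (subst ln_mult_pos) auto
qed

lemma KL_obj_eq:
  assumes a: "a > 0" and b: "b > 0" and v: "v > 0"
  shows "KL_obj (log_inv_gamma_density a b) (\<mu>, v)
       = (- ln (2 * pi) / 2 - ln (b powr a / Gamma a) - 1 / 2) - ln v / 2 + a * \<mu> + b * exp (v / 2 - \<mu>)"
proof -
  define q where "q = gaussian (\<mu>, v)"
  define p where "p = log_inv_gamma_density a b"
  \<comment> \<open>\<open>C\<close> gathers all terms free of \<theta>, with
    \<open>a * \<theta>\<close> written as \<open>a * \<mu> + a * (\<theta> - \<mu>)\<close> so that
    the linear part integrates to 0.\<close>
  define C where "C = - ln (2 * pi) / 2 - ln v / 2 - ln (b powr a / Gamma a) + a * \<mu>"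
  have pos: "q \<theta> > 0" "p \<theta> > 0" for \<theta>
    using a b v by (auto simp: q_def p_def gaussian_def normal_density_pos log_inv_gamma_density_eq Gamma_real_pos)
  note mom = gaussian_moments[OF v, where \<mu> = \<mu>, folded q_def]
  have "has_bochner_integral lborel
      (\<lambda>\<theta>. C * q \<theta> - 1 / (2 * v) * ((\<theta> - \<mu>)\<^sup>2 * q \<theta>) + a * ((\<theta> - \<mu>) * q \<theta>)
          + b * (exp (- \<theta>) * q \<theta>))
      (C * 1 - 1 / (2 * v) * v + a * 0 + b * exp (v / 2 - \<mu>))"
    by (intro has_bochner_integral_add has_bochner_integral_diff has_bochner_integral_mult_right mom)
  also have "(\<lambda>\<theta>. C * q \<theta> - 1 / (2 * v) * ((\<theta> - \<mu>)\<^sup>2 * q \<theta>) + a * ((\<theta> - \<mu>) * q \<theta>)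
          + b * (exp (- \<theta>) * q \<theta>)) = (\<lambda>\<theta>. q \<theta> * ln (q \<theta> / p \<theta>))"
  proof
    fix \<theta>
    have "ln (q \<theta> / p \<theta>) = C - 1 / (2 * v) * (\<theta> - \<mu>)\<^sup>2 + a * (\<theta> - \<mu>) + b * exp (- \<theta>)"
      using pos[of \<theta>] v
      by (simp add: ln_div ln_gaussian[OF v] ln_log_inv_gamma_density[OF a b] q_def p_def C_def
          ln_mult algebra_simps) argo
    then show "C * q \<theta> - 1 / (2 * v) * ((\<theta> - \<mu>)\<^sup>2 * q \<theta>) + a * ((\<theta> - \<mu>) * q \<theta>)
          + b * (exp (- \<theta>) * q \<theta>) = q \<theta> * ln (q \<theta> / p \<theta>)"
      by (simp only: distrib_left right_diff_distrib ac_simps)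
  qed
  finally show ?thesis
    using v by (simp add: KL_obj_def KL_def has_bochner_integral_iff q_def p_def C_def)
qed

text \<open>The squared score difference is expanded and integrated term by term. The cross term
  with \<open>(\<theta> - \<mu>) * exp (- \<theta>)\<close> turns the coefficient \<open>a\<close>
  of \<open>exp (v / 2 - \<mu>)\<close> into \<open>a + 1\<close>.\<close>

lemma Fisher_eq:
  assumes a: "a > 0" and b: "b > 0" and v: "v > 0"
  shows "Fisher (gaussian (\<mu>, v)) (log_inv_gamma_density a b)
       = 1 / v + a\<^sup>2 + (b\<^sup>2 * exp (2 * v - 2 * \<mu>) - 2 * b * (a + 1) * exp (v / 2 - \<mu>))"
proof -
  define q where "q = gaussian (\<mu>, v)"
  define p where "p = log_inv_gamma_density a b"
  note mom = gaussian_moments[OF v, where \<mu> = \<mu>, folded q_def]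
  have dq: "deriv (\<lambda>t. ln (q t)) \<theta> = - (\<theta> - \<mu>) / v" for \<theta>
    unfolding q_def ln_gaussian[OF v] using v
    by (intro DERIV_imp_deriv) (auto intro!: derivative_eq_intros simp: field_simps)
  have dp: "deriv (\<lambda>t. ln (p t)) \<theta> = - a + b * exp (- \<theta>)" for \<theta>
    unfolding p_def ln_log_inv_gamma_density[OF a b]
    by (intro DERIV_imp_deriv) (auto intro!: derivative_eq_intros)
  have "has_bochner_integral lborel
      (\<lambda>\<theta>. 1 / v\<^sup>2 * ((\<theta> - \<mu>)\<^sup>2 * q \<theta>) + a\<^sup>2 * q \<theta> + b\<^sup>2 * ((exp (- \<theta>))\<^sup>2 * q \<theta>)
         - 2 * a / v * ((\<theta> - \<mu>) * q \<theta>) + 2 * b / v * ((\<theta> - \<mu>) * (exp (- \<theta>) * q \<theta>))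
         - 2 * a * b * (exp (- \<theta>) * q \<theta>))
      (1 / v\<^sup>2 * v + a\<^sup>2 * 1 + b\<^sup>2 * exp (2 * v - 2 * \<mu>) - 2 * a / v * 0
         + 2 * b / v * (- v * exp (v / 2 - \<mu>)) - 2 * a * b * exp (v / 2 - \<mu>))"
    (is "has_bochner_integral _ ?f ?I")
    by (intro has_bochner_integral_add has_bochner_integral_diff has_bochner_integral_mult_right mom)
  also have "?f = (\<lambda>\<theta>. q \<theta> * (- (\<theta> - \<mu>) / v - (- a + b * exp (- \<theta>)))\<^sup>2)"
    by (rule ext) (use v in \<open>simp add: power2_eq_square field_simps\<close>)
  also have "?I = 1 / v + a\<^sup>2 + (b\<^sup>2 * exp (2 * v - 2 * \<mu>) - 2 * b * (a + 1) * exp (v / 2 - \<mu>))"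
    using v by (simp add: power2_eq_square algebra_simps)
  finally show ?thesis
    unfolding Fisher_def q_def[symmetric] p_def[symmetric] dq dp by (simp add: has_bochner_integral_iff)
qed

section \<open>Stationarity of the optimal parameters\<close>

lemma optimal_params_pos:
  assumes "optimal_params D (\<mu>, v)"
  shows "v > 0"
  using assms by (auto simp: optimal_params_def is_arg_min_def is_local_arg_min_def)

text \<open>Both cases of \<open>optimal_params\<close> give a local minimum in the half-plane, and
  composing with a curve through it gives a local minimum of one real variable. This serves the
  coordinate lines as well as the curve on which the mean is optimal for given variance.\<close>

lemma optimal_params_curve:
  fixes m w :: "real \<Rightarrow> real"
  assumes opt: "optimal_params D (m t, w t)"
    and cont: "isCont m t" "isCont w t"
    and f: "\<And>s. w s > 0 \<Longrightarrow> D (m s, w s) = f s"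
  shows "\<exists>d>0. \<forall>s. \<bar>t - s\<bar> < d \<longrightarrow> f t \<le> f s"
proof -
  let ?P = "\<lambda>(\<mu>, v). v > (0::real)"
  have pos: "w t > 0" using opt by (rule optimal_params_pos)
  \<comment> \<open>Openness keeps the curve inside the half-plane near \<open>t\<close>, so
    \<open>f\<close> represents the objective there.\<close>
  have "open (Collect ?P)"
    unfolding case_prod_beta by (intro open_Collect_less continuous_intros)
  then have P: "\<forall>\<^sub>F y in nhds (m t, w t). ?P y"
    using pos by (auto simp: eventually_nhds)
  have "\<forall>\<^sub>F y in nhds (m t, w t). ?P y \<longrightarrow> D (m t, w t) \<le> D y"
  proof (cases "is_arg_min D ?P (m t, w t)")
    case True
    then show ?thesis by (intro always_eventually) (auto simp: is_arg_min_def not_less, metis leD)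
  next
    case False
    then have "\<forall>\<^sub>F y in at (m t, w t) within Collect ?P. D (m t, w t) \<le> D y"
      using opt by (auto simp: optimal_params_def is_local_arg_min_def)
    then show ?thesis
      unfolding eventually_at_filter by eventually_elim auto
  qed
  moreover have lim: "((\<lambda>s. (m s, w s)) \<longlongrightarrow> (m t, w t)) (nhds t)"
    using cont by (intro tendsto_Pair) (simp_all add: isCont_def tendsto_at_iff_tendsto_nhds)
  ultimately have "\<forall>\<^sub>F s in nhds t. ?P (m s, w s) \<longrightarrow> D (m t, w t) \<le> D (m s, w s)"
    by (rule eventually_compose_filterlim)
  moreover from P lim have "\<forall>\<^sub>F s in nhds t. ?P (m s, w s)"
    by (rule eventually_compose_filterlim)
  ultimately have "\<forall>\<^sub>F s in nhds t. f t \<le> f s"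
    by eventually_elim (use f pos in auto)
  then show ?thesis
    unfolding eventually_nhds_metric dist_real_def by (simp only: abs_minus_commute[of t])
qed

lemma optimal_params_stationary:
  fixes m w :: "real \<Rightarrow> real"
  assumes "optimal_params D (m t, w t)" "isCont m t" "isCont w t"
    and "\<And>s. w s > 0 \<Longrightarrow> D (m s, w s) = f s"
    and "(f has_real_derivative l) (at t)"
  shows "l = 0"
  using optimal_params_curve[OF assms(1-4)] DERIV_local_min[OF assms(5)] by blast

text \<open>Stationarity in \<mu> fixes \<open>b * exp (v / 2 - \<mu>)\<close> as \<open>a\<close>;
  inserted into stationarity in \<open>v\<close>, this determines \<open>v\<close>.\<close>

lemma KL_optimal:
  assumes a: "a > 0" and b: "b > 0"
    and opt: "optimal_params (KL_obj (log_inv_gamma_density a b)) (\<mu>, v)"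
  shows "v = 1 / a" "\<mu> = ln (b / a) + 1 / (2 * a)"
proof -
  have v: "v > 0" using opt by (rule optimal_params_pos)
  note eq = KL_obj_eq[OF a b]
  have "a - b * exp (v / 2 - \<mu>) = 0"
    by (rule optimal_params_stationary[where m = "\<lambda>s. s" and w = "\<lambda>_. v" and t = \<mu>, OF opt _ _ eq])
       (auto intro!: derivative_eq_intros)
  then have e: "b * exp (v / 2 - \<mu>) = a" by simp
  have "- 1 / (2 * v) + b * exp (v / 2 - \<mu>) / 2 = 0"
    by (rule optimal_params_stationary[where m = "\<lambda>_. \<mu>" and w = "\<lambda>s. s" and t = v, OF opt _ _ eq])
       (use v in \<open>auto intro!: derivative_eq_intros simp: field_simps\<close>)
  then have "- 1 / (2 * v) + a / 2 = 0" unfolding e .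
  then show v': "v = 1 / a" using a v by (simp add: field_simps)
  have "ln (b * exp (v / 2 - \<mu>)) = ln a" using e by simp
  then have "\<mu> - v / 2 = ln (b / a)" using a b by (simp add: ln_mult ln_div)
  then show "\<mu> = ln (b / a) + 1 / (2 * a)" by (simp add: v' field_simps)
qed

text \<open>The third premise is the vanishing \<mu>-derivative of the Fisher objective. The score
  objective is \<open>v\<close> times the Fisher objective, so the same curve serves both.\<close>

lemma Fisher_mean_stationary:
  fixes a b \<mu> v :: real
  assumes "a > 0" "b > 0"
    and "- 2 * b\<^sup>2 * exp (2 * v - 2 * \<mu>) + 2 * b * (a + 1) * exp (v / 2 - \<mu>) = 0"
  shows "\<mu> = ln b - ln (a + 1) + 3 / 2 * v"
proof -
  have "2 * (b * ((a + 1) * exp (v / 2 - \<mu>) - b * exp (2 * v - 2 * \<mu>))) = 0"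
    using assms(3) by (simp add: power2_eq_square algebra_simps)
  then have "b * exp (2 * v - 2 * \<mu>) = (a + 1) * exp (v / 2 - \<mu>)"
    using assms(2) by simp
  then have "ln (b * exp (2 * v - 2 * \<mu>)) = ln ((a + 1) * exp (v / 2 - \<mu>))" by simp
  then show ?thesis using assms(1,2) by (simp add: ln_mult)
qed

text \<open>On the stationary curve \<open>b * exp (v / 2 - \<mu>)\<close> becomes
  \<open>(a + 1) * exp (- v)\<close>, which reduces both objectives to functions of \<open>v\<close>
  alone.\<close>

lemma Fisher_profile:
  fixes a b \<mu> v :: real
  assumes "a > 0" "b > 0"
  defines "\<mu> \<equiv> ln b - ln (a + 1) + 3 / 2 * v"
  shows "b\<^sup>2 * exp (2 * v - 2 * \<mu>) - 2 * b * (a + 1) * exp (v / 2 - \<mu>) = - ((a + 1)\<^sup>2 * exp (- v))"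
proof -
  have "b * exp (v / 2 - \<mu>) = b * exp (- v + ln (a + 1) + - ln b)"
    by (simp add: \<mu>_def algebra_simps)
  also have "\<dots> = (a + 1) * exp (- v)"
    using assms(1,2) by (simp only: exp_add) (simp add: exp_minus)
  finally have 1: "b * exp (v / 2 - \<mu>) = (a + 1) * exp (- v)" .
  have "2 * v - 2 * \<mu> = v + 2 * (v / 2 - \<mu>)" by simp
  then have "b\<^sup>2 * exp (2 * v - 2 * \<mu>) = exp v * (b * exp (v / 2 - \<mu>))\<^sup>2"
    by (simp only: exp_add exp_double) (simp add: power_mult_distrib)
  also have "\<dots> = (a + 1)\<^sup>2 * exp (- v)"
    unfolding 1 by (simp add: power_mult_distrib exp_minus power2_eq_square)
  finally have 2: "b\<^sup>2 * exp (2 * v - 2 * \<mu>) = (a + 1)\<^sup>2 * exp (- v)" .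
  have "2 * b * (a + 1) * exp (v / 2 - \<mu>) = 2 * (a + 1) * (b * exp (v / 2 - \<mu>))" by simp
  also have "\<dots> = 2 * ((a + 1)\<^sup>2 * exp (- v))"
    unfolding 1 by (simp add: power2_eq_square)
  finally show ?thesis using 2 by simp
qed

lemma Score_optimal:
  assumes a: "a > 0" and b: "b > 0"
    and opt: "optimal_params (Score_obj (log_inv_gamma_density a b)) (\<mu>, v)"
  shows "\<mu> = ln b - ln (a + 1) + 3 / 2 * v" "(a + 1)\<^sup>2 * ((1 - v) * exp (- v)) = a\<^sup>2"
proof -
  have v: "v > 0" using opt by (rule optimal_params_pos)
  have eq: "Score_obj (log_inv_gamma_density a b) (\<mu>, v) = v *
      (1 / v + a\<^sup>2 + (b\<^sup>2 * exp (2 * v - 2 * \<mu>) - 2 * b * (a + 1) * exp (v / 2 - \<mu>)))"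
    if "v > 0" for \<mu> v
    using that by (simp add: Score_obj_def Fisher_eq[OF a b])
  have "v * (- 2 * b\<^sup>2 * exp (2 * v - 2 * \<mu>) + 2 * b * (a + 1) * exp (v / 2 - \<mu>)) = 0"
    by (rule optimal_params_stationary[where m = "\<lambda>s. s" and w = "\<lambda>_. v" and t = \<mu>, OF opt _ _ eq])
       (auto intro!: derivative_eq_intros simp: algebra_simps)
  then show m: "\<mu> = ln b - ln (a + 1) + 3 / 2 * v"
    using v by (intro Fisher_mean_stationary[OF a b]) simp
  have "a\<^sup>2 - (a + 1)\<^sup>2 * ((1 - v) * exp (- v)) = 0"
  proof (rule optimal_params_stationary[where w = "\<lambda>s. s"])
    show "optimal_params (Score_obj (log_inv_gamma_density a b)) (ln b - ln (a + 1) + 3 / 2 * v, v)"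
      using opt m by simp
    show "Score_obj (log_inv_gamma_density a b) (ln b - ln (a + 1) + 3 / 2 * s, s)
        = 1 + s * a\<^sup>2 - (a + 1)\<^sup>2 * (s * exp (- s))" if "s > 0" for s
      unfolding eq[OF that] Fisher_profile[OF a b] using that by (simp add: field_simps)
    show "((\<lambda>s. 1 + s * a\<^sup>2 - (a + 1)\<^sup>2 * (s * exp (- s))) has_real_derivative
        a\<^sup>2 - (a + 1)\<^sup>2 * ((1 - v) * exp (- v))) (at v)"
      by (auto intro!: derivative_eq_intros simp: algebra_simps)
  qed auto
  then show "(a + 1)\<^sup>2 * ((1 - v) * exp (- v)) = a\<^sup>2" by simp
qed

text \<open>The equation for \<open>v\<close> can have two roots, one on each side of 2, so
  stationarity does not suffice: the local minimum property itself excludes the larger one.\<close>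

lemma Fisher_optimal:
  assumes a: "a > 0" and b: "b > 0"
    and opt: "optimal_params (Fisher_obj (log_inv_gamma_density a b)) (\<mu>, v)"
  shows "\<mu> = ln b - ln (a + 1) + 3 / 2 * v" "v * (a + 1) = exp (v / 2)" "v < 2"
proof -
  have v: "v > 0" using opt by (rule optimal_params_pos)
  have eq: "Fisher_obj (log_inv_gamma_density a b) (\<mu>, v) =
      1 / v + a\<^sup>2 + (b\<^sup>2 * exp (2 * v - 2 * \<mu>) - 2 * b * (a + 1) * exp (v / 2 - \<mu>))"
    if "v > 0" for \<mu> v
    using that by (simp add: Fisher_obj_def Fisher_eq[OF a b])
  have "- 2 * b\<^sup>2 * exp (2 * v - 2 * \<mu>) + 2 * b * (a + 1) * exp (v / 2 - \<mu>) = 0"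
    by (rule optimal_params_stationary[where m = "\<lambda>s. s" and w = "\<lambda>_. v" and t = \<mu>, OF opt _ _ eq])
       (auto intro!: derivative_eq_intros simp: algebra_simps)
  then show m: "\<mu> = ln b - ln (a + 1) + 3 / 2 * v"
    by (intro Fisher_mean_stationary[OF a b])
  define f where "f = (\<lambda>s. 1 / s + a\<^sup>2 - (a + 1)\<^sup>2 * exp (- s))"
  have f: "Fisher_obj (log_inv_gamma_density a b) (ln b - ln (a + 1) + 3 / 2 * s, s) = f s"
    if "s > 0" for s
    unfolding eq[OF that] Fisher_profile[OF a b] by (simp add: f_def)
  have df: "(f has_real_derivative (a + 1)\<^sup>2 * exp (- s) - 1 / s\<^sup>2) (at s)" if "s > 0" for s
    unfolding f_def using that by (auto intro!: derivative_eq_intros simp: power2_eq_square)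
  have opt': "optimal_params (Fisher_obj (log_inv_gamma_density a b)) (ln b - ln (a + 1) + 3 / 2 * v, v)"
    using opt m by simp
  have "(a + 1)\<^sup>2 * exp (- v) - 1 / v\<^sup>2 = 0"
    by (rule optimal_params_stationary[where w = "\<lambda>s. s", OF opt' _ _ f df[OF v]]) auto
  then have "(v * (a + 1))\<^sup>2 = (exp (v / 2))\<^sup>2"
    using v by (simp add: exp_minus divide_simps power_mult_distrib mult.commute flip: exp_double)
  then show stat: "v * (a + 1) = exp (v / 2)"
    using v a by (simp add: power2_eq_iff_nonneg)
  txt \<open>For \<open>v \<ge> 2\<close> the stationary point is a local maximum along the curve.\<close>
  show "v < 2"
  proof (rule ccontr)
    assume "\<not> v < 2"
    then have v2: "v \<ge> 2" by simp
    obtain d where d: "d > 0" "\<And>s. \<bar>v - s\<bar> < d \<Longrightarrow> f v \<le> f s"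
      using optimal_params_curve[where w = "\<lambda>s. s", OF opt' _ _ f] by auto
    have "f (v + d / 2) < f v"
    proof (rule DERIV_neg_imp_decreasing_open[where f = f])
      fix s assume s: "v < s" "s < v + d / 2"
      \<comment> \<open>Here \<open>v \<ge> 2\<close> enters, as
        \<open>s / v = 1 + (s - v) / v\<close>. Hence \<open>s * (a + 1)\<close> falls below
        \<open>exp (s / 2)\<close> after their equality at \<open>v\<close>, and \<open>f\<close>
        decreases to the right of \<open>v\<close>.\<close>
      have "s / v \<le> 1 + (s - v) / 2"
        using s v2 mult_right_mono[of 2 v "s - v"] by (simp add: field_simps)
      also have "\<dots> < exp ((s - v) / 2)"
        using exp_minus_greater[of "- ((s - v) / 2)"] s by simp
      finally have "s < v * exp ((s - v) / 2)" using v by (simp add: field_simps)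
      then have "s * (a + 1) < (v * (a + 1)) * exp ((s - v) / 2)"
        using a by (simp add: mult.commute mult.left_commute)
      also have "\<dots> = exp (s / 2)"
        unfolding stat by (simp flip: exp_add add: field_simps)
      finally have "(s * (a + 1))\<^sup>2 < (exp (s / 2))\<^sup>2"
        using s v a by (intro power_strict_mono) auto
      then have "s\<^sup>2 * (a + 1)\<^sup>2 < exp s"
        by (simp add: power_mult_distrib flip: exp_double)
      then have "(a + 1)\<^sup>2 * exp (- s) - 1 / s\<^sup>2 < 0"
        using s v by (simp add: exp_minus divide_simps mult.commute)
      with df[of s] s v show "\<exists>y. (f has_real_derivative y) (at s) \<and> y < 0" by auto
    next
      show "continuous_on {v..v + d / 2} f"
        unfolding f_def using v by (intro continuous_intros) auto
    qed (use d in auto)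
    moreover have "f v \<le> f (v + d / 2)" using d by simp
    ultimately show False by simp
  qed
qed

section \<open>Moments of the log inverse gamma distribution\<close>

lemma borel_measurable_log_inv_gamma_density [measurable]:
  "log_inv_gamma_density a b \<in> borel_measurable borel"
  unfolding log_inv_gamma_density_eq[abs_def] by measurable

lemma log_inv_gamma_density_pos:
  assumes "a > 0" "b > 0"
  shows "log_inv_gamma_density a b \<theta> > 0"
  using assms by (simp add: log_inv_gamma_density_eq Gamma_real_pos)

text \<open>Substitution of \<open>b * exp (- \<theta>)\<close> in the Gamma integral; nonnegativity
  of the density then carries the result over to the Bochner integral.\<close>

lemma has_bochner_integral_log_inv_gamma_density:
  assumes a: "a > 0" and b: "b > 0"
  shows "has_bochner_integral lborel (log_inv_gamma_density a b) 1"
proof -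
  define f :: "real \<Rightarrow> real" where "f = (\<lambda>t. t powr (a - 1) / exp t)"
  define g :: "real \<Rightarrow> real" where "g = (\<lambda>\<theta>. b * exp (- \<theta>))"
  have "range g = {0<..}"
  proof (rule set_eqI)
    fix t
    show "t \<in> range g \<longleftrightarrow> t \<in> {0<..}"
      using b by (auto simp: g_def exp_minus intro!: image_eqI[of _ _ "ln (b / t)"])
  qed
  have "(f has_integral Gamma a) {0..}"
    unfolding f_def using Gamma_integral_real[OF a] .
  \<comment> \<open>The point 0 is removed because the substitution maps onto the open
    half-line.\<close>
  then have f: "(f has_integral Gamma a) {0<..}"
    by (subst has_integral_spike_set_eq[of _ "{0..}"])
       (auto intro: negligible_subset[of "{0}"])
  have "f absolutely_integrable_on {0<..}"
    using f by (intro nonnegative_absolutely_integrable_1) (auto simp: f_def has_integral_integrable)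
  moreover have "integral {0<..} f = Gamma a"
    using f by (rule integral_unique)
  ultimately have "f absolutely_integrable_on (g ` UNIV) \<and> integral (g ` UNIV) f = Gamma a"
    using \<open>range g = {0<..}\<close> by simp
  then have "(\<lambda>x. \<bar>- b * exp (- x)\<bar> * f (g x)) absolutely_integrable_on UNIV \<and>
      integral UNIV (\<lambda>x. \<bar>- b * exp (- x)\<bar> * f (g x)) = Gamma a"
    by (rule has_absolute_integral_change_of_variables_1'[THEN iffD2, rotated 3])
       (use b in \<open>auto simp: g_def inj_on_def intro!: derivative_eq_intros\<close>)
  then have "((\<lambda>x. \<bar>- b * exp (- x)\<bar> * f (g x)) has_integral Gamma a) UNIV"
    by (metis set_lebesgue_integral_eq_integral(1) integrable_integral)
  moreover have "\<bar>- b * exp (- x)\<bar> * f (g x) = Gamma a * log_inv_gamma_density a b x" for x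
  proof -
    have "\<bar>- b * exp (- x)\<bar> * f (g x) = g x powr 1 * g x powr (a - 1) * exp (- g x)"
      using b by (simp add: f_def g_def exp_minus divide_inverse)
    also have "g x powr 1 * g x powr (a - 1) = g x powr a"
      by (simp only: powr_add[symmetric]) simp
    also have "\<dots> = b powr a * exp (- a * x)"
      using b by (simp add: g_def powr_mult) (simp add: powr_def)
    finally show ?thesis
      using Gamma_real_pos[OF a]
      by (simp add: log_inv_gamma_density_eq g_def exp_diff exp_minus divide_inverse)
  qed
  ultimately have "((\<lambda>x. Gamma a * log_inv_gamma_density a b x) has_integral Gamma a) UNIV"
    by simp
  from has_integral_mult_right[OF this, of "inverse (Gamma a)"]
  have "(log_inv_gamma_density a b has_integral 1) UNIV"
    using Gamma_real_pos[OF a] by (simp flip: mult.assoc)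
  then have "(\<integral>\<^sup>+x. ennreal (log_inv_gamma_density a b x) \<partial>lborel) = ennreal 1"
    using log_inv_gamma_density_pos[OF a b]
    by (intro nn_integral_has_integral_lborel) (auto intro: less_imp_le)
  then show ?thesis
    using log_inv_gamma_density_pos[OF a b]
    by (intro has_bochner_integral_nn_integral) (auto intro: less_imp_le)
qed

text \<open>Exponential tilting stays within the family and shifts the shape by \<open>k\<close>,
  which may be negative. Exponential moments thus reduce to normalisation at another shape.\<close>

lemma exp_mult_log_inv_gamma_density:
  assumes "a > 0" "b > 0" "a + k > 0"
  shows "exp (- k * \<theta>) * log_inv_gamma_density a b \<theta>
       = (Gamma (a + k) / (Gamma a * b powr k)) * log_inv_gamma_density (a + k) b \<theta>"
proof -
  have "exp (- k * \<theta>) * exp (- a * \<theta> - b * exp (- \<theta>)) = exp (- (a + k) * \<theta> - b * exp (- \<theta>))"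
    by (simp add: algebra_simps flip: exp_add)
  then show ?thesis
    using assms less_imp_neq[OF Gamma_real_pos[of a]] less_imp_neq[OF Gamma_real_pos[of "a + k"]]
    by (simp add: log_inv_gamma_density_eq powr_add field_simps)
qed

lemma exp_minus_mult_log_inv_gamma_density:
  assumes "a > 0" "b > 0"
  shows "exp (- \<theta>) * log_inv_gamma_density a b \<theta> = a / b * log_inv_gamma_density (a + 1) b \<theta>"
proof -
  have "Gamma (a + 1) = a * Gamma a"
    using assms by (intro Gamma_plus1) (auto dest: nonpos_Ints_nonpos)
  then show ?thesis
    using exp_mult_log_inv_gamma_density[of a b 1 \<theta>] assms less_imp_neq[OF Gamma_real_pos[of a]]
    by simp
qed

text \<open>The square of \<theta> is dominated by exponentials with rates \<open>a / 2\<close> and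
  \<open>- (a / 2)\<close>, whose tilts have the positive shapes \<open>3 * a / 2\<close> and
  \<open>a / 2\<close>. The factor 8 comes from bounding half the square of
  \<open>a / 2 * \<theta>\<close> by an exponential. The first moment is dominated by the second
  plus the density.\<close>

lemma integrable_power_log_inv_gamma_density:
  assumes a: "a > 0" and b: "b > 0"
  shows "integrable lborel (\<lambda>\<theta>. \<theta>\<^sup>2 * log_inv_gamma_density a b \<theta>)"
    and "integrable lborel (\<lambda>\<theta>. \<theta> * log_inv_gamma_density a b \<theta>)"
proof -
  let ?p = "log_inv_gamma_density a b"
  note p = log_inv_gamma_density_pos[OF a b]
  have int: "integrable lborel (\<lambda>\<theta>. exp (- k * \<theta>) * ?p \<theta>)" if "a + k > 0" for k
    unfolding exp_mult_log_inv_gamma_density[OF a b that]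
    using has_bochner_integral_log_inv_gamma_density[OF that b]
    by (intro integrable_mult_right) (auto simp: has_bochner_integral_iff)
  have "\<theta>\<^sup>2 \<le> 8 / a\<^sup>2 * (exp (- (a / 2) * \<theta>) + exp (- (- (a / 2)) * \<theta>))" for \<theta>
  proof -
    have "(a / 2 * \<theta>)\<^sup>2 / 2 \<le> exp \<bar>a / 2 * \<theta>\<bar>"
    proof -
      have "(a / 2 * \<theta>)\<^sup>2 / 2 = \<bar>a / 2 * \<theta>\<bar>\<^sup>2 / 2"
        by (simp only: power2_abs)
      moreover have "0 \<le> \<bar>a / 2 * \<theta>\<bar> ^ 3 / 6" by simp
      ultimately show ?thesis
        using exp_lower_cubic[of "\<bar>a / 2 * \<theta>\<bar>"] by linarith
    qed
    also have "\<dots> \<le> exp (- (a / 2) * \<theta>) + exp (- (- (a / 2)) * \<theta>)"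
      by (auto simp: abs_if)
    finally show ?thesis
      using a by (simp add: field_simps power2_eq_square)
  qed
  then have le: "\<theta>\<^sup>2 * ?p \<theta> \<le> 8 / a\<^sup>2 * (exp (- (a / 2) * \<theta>) * ?p \<theta> + exp (- (- (a / 2)) * \<theta>) * ?p \<theta>)" for \<theta>
    using mult_right_mono[OF _ less_imp_le[OF p[of \<theta>]]]
    unfolding distrib_right[symmetric] mult.assoc[symmetric] by blast
  show sq: "integrable lborel (\<lambda>\<theta>. \<theta>\<^sup>2 * ?p \<theta>)"
  proof (rule Bochner_Integration.integrable_bound)
    show "integrable lborel (\<lambda>\<theta>. 8 / a\<^sup>2 * (exp (- (a / 2) * \<theta>) * ?p \<theta> + exp (- (- (a / 2)) * \<theta>) * ?p \<theta>))"
      using a by (intro integrable_mult_right Bochner_Integration.integrable_add int) auto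
    show "AE \<theta> in lborel. norm (\<theta>\<^sup>2 * ?p \<theta>)
        \<le> norm (8 / a\<^sup>2 * (exp (- (a / 2) * \<theta>) * ?p \<theta> + exp (- (- (a / 2)) * \<theta>) * ?p \<theta>))"
    proof (rule AE_I2)
      fix \<theta>
      have "norm (\<theta>\<^sup>2 * ?p \<theta>) = \<theta>\<^sup>2 * ?p \<theta>" using p[of \<theta>] by simp
      with le[of \<theta>] show "norm (\<theta>\<^sup>2 * ?p \<theta>)
        \<le> norm (8 / a\<^sup>2 * (exp (- (a / 2) * \<theta>) * ?p \<theta> + exp (- (- (a / 2)) * \<theta>) * ?p \<theta>))"
        unfolding real_norm_def by linarith
    qed
  qed measurable
  show "integrable lborel (\<lambda>\<theta>. \<theta> * ?p \<theta>)"
  proof (rule Bochner_Integration.integrable_bound)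
    show "integrable lborel (\<lambda>\<theta>. \<theta>\<^sup>2 * ?p \<theta> + ?p \<theta>)"
      using has_bochner_integral_log_inv_gamma_density[OF a b] sq
      by (intro Bochner_Integration.integrable_add) (auto simp: has_bochner_integral_iff)
    show "AE \<theta> in lborel. norm (\<theta> * ?p \<theta>) \<le> norm (\<theta>\<^sup>2 * ?p \<theta> + ?p \<theta>)"
    proof (rule AE_I2)
      fix \<theta> :: real
      have "0 \<le> (\<bar>\<theta>\<bar> - 1)\<^sup>2 + \<bar>\<theta>\<bar>" by simp
      then have "\<bar>\<theta>\<bar> \<le> \<theta>\<^sup>2 + 1" by (simp add: power2_diff)
      from mult_right_mono[OF this less_imp_le[OF p[of \<theta>]]]
      show "norm (\<theta> * ?p \<theta>) \<le> norm (\<theta>\<^sup>2 * ?p \<theta> + ?p \<theta>)"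
        using p[of \<theta>] by (simp add: abs_mult distrib_right)
    qed
  qed measurable
qed

text \<open>The integrand is the derivative of \<theta> times the density, and this product vanishes
  at both infinities. Integrability follows by absorbing \<open>exp (- \<theta>)\<close> into the
  density of shape \<open>a + 1\<close>.\<close>

lemma integral_log_inv_gamma_density_Stein:
  assumes a: "a > 0" and b: "b > 0"
  shows "(\<integral>\<theta>. log_inv_gamma_density a b \<theta>
             + \<theta> * ((- a + b * exp (- \<theta>)) * log_inv_gamma_density a b \<theta>) \<partial>lborel) = 0"
    (is "(\<integral>\<theta>. ?f \<theta> \<partial>lborel) = 0")
proof -
  let ?p = "log_inv_gamma_density a b"
  let ?F = "\<lambda>\<theta>. \<theta> * ?p \<theta>"
  define K where "K = b powr a / Gamma a"
  have p: "?p = (\<lambda>\<theta>. K * exp (- a * \<theta> - b * exp (- \<theta>)))"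
    unfolding K_def by (rule ext) (rule log_inv_gamma_density_eq)
  have f: "?f = (\<lambda>\<theta>. ?p \<theta> - a * (\<theta> * ?p \<theta>) + a * (\<theta> * log_inv_gamma_density (a + 1) b \<theta>))"
    (is "_ = ?g")
  proof
    fix \<theta>
    have "?f \<theta> = ?p \<theta> - a * (\<theta> * ?p \<theta>) + b * (\<theta> * (exp (- \<theta>) * ?p \<theta>))"
      by (simp add: algebra_simps)
    then show "?f \<theta> = ?g \<theta>"
      using a b by (simp add: exp_minus_mult_log_inv_gamma_density)
  qed
  have int: "integrable lborel ?f"
    unfolding f using a b has_bochner_integral_log_inv_gamma_density[OF a b]
    by (intro Bochner_Integration.integrable_add Bochner_Integration.integrable_diff
        integrable_mult_right integrable_power_log_inv_gamma_density)
       (auto simp: has_bochner_integral_iff)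
  have "(LBINT \<theta>=-\<infinity>..\<infinity>. ?f \<theta>) = 0 - 0"
  proof (rule interval_integral_FTC_integrable)
    show "(?F has_vector_derivative ?f x) (at x)" for x
      unfolding p has_real_derivative_iff_has_vector_derivative[symmetric]
      by (auto intro!: derivative_eq_intros simp: algebra_simps)
    show "isCont ?f x" for x
      unfolding p by (intro continuous_intros)
    show "set_integrable lborel (einterval (-\<infinity>) \<infinity>) ?f"
      using int by (simp add: set_integrable_def)
    have "((\<lambda>\<theta>. \<theta> * exp (- a * \<theta> - b * exp (- \<theta>))) \<longlongrightarrow> 0) at_bot"
      "((\<lambda>\<theta>. \<theta> * exp (- a * \<theta> - b * exp (- \<theta>))) \<longlongrightarrow> 0) at_top"
      using a b by real_asymp+
    from this[THEN tendsto_mult_right_zero, of K]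
    have "(?F \<longlongrightarrow> 0) at_bot" "(?F \<longlongrightarrow> 0) at_top"
      by (simp_all add: p mult.left_commute)
    then show "((?F \<circ> real_of_ereal) \<longlongrightarrow> 0) (at_right (-\<infinity>))"
      "((?F \<circ> real_of_ereal) \<longlongrightarrow> 0) (at_left \<infinity>)"
      by (simp_all add: ereal_tendsto_simps)
  qed auto
  then show ?thesis
    by (simp add: interval_lebesgue_integral_def set_lebesgue_integral_def)
qed

lemma mean_of_log_inv_gamma_density:
  assumes "a > 0" "b > 0"
  shows "mean_of (log_inv_gamma_density a b) = (\<integral>\<theta>. \<theta> * log_inv_gamma_density a b \<theta> \<partial>lborel)"
  unfolding mean_of_def using less_imp_le[OF log_inv_gamma_density_pos[OF assms]]
  by (subst integral_real_density) (auto simp: mult.commute)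

lemma variance_of_log_inv_gamma_density:
  assumes "a > 0" "b > 0"
  shows "variance_of (log_inv_gamma_density a b) =
    (\<integral>\<theta>. (\<theta> - mean_of (log_inv_gamma_density a b))\<^sup>2 * log_inv_gamma_density a b \<theta> \<partial>lborel)"
  unfolding variance_of_def using less_imp_le[OF log_inv_gamma_density_pos[OF assms]]
  by (subst integral_real_density) (auto simp: mult.commute)

text \<open>Each factor \<open>exp (- \<theta>)\<close> raises the shape by one. The mixed moment is
  therefore a multiple of the mean at shape \<open>a + 1\<close>, which the Stein identity relates
  to the mean at shape \<open>a\<close>.\<close>

lemma log_inv_gamma_moments:
  assumes a: "a > 0" and b: "b > 0"
  defines "p \<equiv> log_inv_gamma_density a b"
  shows "has_bochner_integral lborel (\<lambda>\<theta>. \<theta> * p \<theta>) (mean_of p)"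
    and "has_bochner_integral lborel (\<lambda>\<theta>. exp (- \<theta>) * p \<theta>) (a / b)"
    and "has_bochner_integral lborel (\<lambda>\<theta>. (exp (- \<theta>))\<^sup>2 * p \<theta>) (a * (a + 1) / b\<^sup>2)"
    and "has_bochner_integral lborel (\<lambda>\<theta>. \<theta> * (exp (- \<theta>) * p \<theta>)) ((a * mean_of p - 1) / b)"
    and "mean_of (log_inv_gamma_density (a + 1) b) = mean_of p - 1 / a"
proof -
  have a1: "a + 1 > 0" and a2: "a + 1 + 1 > 0" using a by auto
  note norm = has_bochner_integral_log_inv_gamma_density[OF _ b]
  note e = exp_minus_mult_log_inv_gamma_density[OF _ b]
  show m: "has_bochner_integral lborel (\<lambda>\<theta>. \<theta> * p \<theta>) (mean_of p)"
    unfolding p_def mean_of_log_inv_gamma_density[OF a b]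
    by (intro has_bochner_integral_integrable integrable_power_log_inv_gamma_density a b)
  have m1: "has_bochner_integral lborel (\<lambda>\<theta>. \<theta> * log_inv_gamma_density (a + 1) b \<theta>)
      (mean_of (log_inv_gamma_density (a + 1) b))"
    unfolding p_def mean_of_log_inv_gamma_density[OF a1 b]
    by (intro has_bochner_integral_integrable integrable_power_log_inv_gamma_density a1 b)
  show "has_bochner_integral lborel (\<lambda>\<theta>. exp (- \<theta>) * p \<theta>) (a / b)"
    unfolding p_def e[OF a] using has_bochner_integral_mult_right[OF norm[OF a1], of "a / b"] by simp
  have "(exp (- \<theta>))\<^sup>2 * p \<theta> = a * (a + 1) / b\<^sup>2 * log_inv_gamma_density (a + 1 + 1) b \<theta>" for \<theta>
  proof -
    have "(exp (- \<theta>))\<^sup>2 * p \<theta> = exp (- \<theta>) * (exp (- \<theta>) * p \<theta>)"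
      by (simp add: power2_eq_square mult.assoc)
    also have "\<dots> = a / b * (exp (- \<theta>) * log_inv_gamma_density (a + 1) b \<theta>)"
      unfolding p_def e[OF a] by (simp only: ac_simps)
    finally show ?thesis unfolding e[OF a1] by (simp add: power2_eq_square)
  qed
  then show "has_bochner_integral lborel (\<lambda>\<theta>. (exp (- \<theta>))\<^sup>2 * p \<theta>) (a * (a + 1) / b\<^sup>2)"
    using has_bochner_integral_mult_right[OF norm[OF a2], of "a * (a + 1) / b\<^sup>2"] by simp
  have T: "has_bochner_integral lborel (\<lambda>\<theta>. \<theta> * (exp (- \<theta>) * p \<theta>))
      (a / b * mean_of (log_inv_gamma_density (a + 1) b))"
    using has_bochner_integral_mult_right[OF m1, of "a / b"] by (simp add: p_def e[OF a] ac_simps)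
  have "has_bochner_integral lborel (\<lambda>\<theta>. p \<theta> - a * (\<theta> * p \<theta>) + b * (\<theta> * (exp (- \<theta>) * p \<theta>)))
      (1 - a * mean_of p + b * (a / b * mean_of (log_inv_gamma_density (a + 1) b)))"
    using norm[OF a] m T unfolding p_def
    by (intro has_bochner_integral_add has_bochner_integral_diff has_bochner_integral_mult_right) auto
  also have "(\<lambda>\<theta>. p \<theta> - a * (\<theta> * p \<theta>) + b * (\<theta> * (exp (- \<theta>) * p \<theta>)))
      = (\<lambda>\<theta>. p \<theta> + \<theta> * ((- a + b * exp (- \<theta>)) * p \<theta>))"
    by (rule ext) (simp add: algebra_simps)
  finally have "1 - a * mean_of p + a * mean_of (log_inv_gamma_density (a + 1) b) = 0"
    using integral_log_inv_gamma_density_Stein[OF a b] b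
    by (simp add: has_bochner_integral_iff p_def)
  then show *: "mean_of (log_inv_gamma_density (a + 1) b) = mean_of p - 1 / a"
    using a by (simp add: field_simps)
  show "has_bochner_integral lborel (\<lambda>\<theta>. \<theta> * (exp (- \<theta>) * p \<theta>)) ((a * mean_of p - 1) / b)"
  proof -
    have e: "a / b * (mean_of p - 1 / a) = (a * mean_of p - 1) / b"
      using a b by (simp add: field_simps)
    show ?thesis using T unfolding * e .
  qed
qed

text \<open>If the integral were 0, the interval \<open>{c..c + 1}\<close>, on which the integrand
  is positive, would be a null set. This is the source of strictness in the variance bound.\<close>

lemma integral_log_inv_gamma_pos:
  assumes a: "a > 0" and b: "b > 0"
  defines "p \<equiv> log_inv_gamma_density a b"
  assumes int: "has_bochner_integral lborel (\<lambda>\<theta>. (h \<theta>)\<^sup>2 * p \<theta>) I"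
    and h: "\<And>\<theta>. \<theta> \<ge> c \<Longrightarrow> h \<theta> \<noteq> 0"
  shows "I > 0"
proof -
  note p = log_inv_gamma_density_pos[OF a b, folded p_def]
  have nonneg: "0 \<le> (h \<theta>)\<^sup>2 * p \<theta>" for \<theta>
    using p[of \<theta>] by simp
  have I: "I = (\<integral>\<theta>. (h \<theta>)\<^sup>2 * p \<theta> \<partial>lborel)" "integrable lborel (\<lambda>\<theta>. (h \<theta>)\<^sup>2 * p \<theta>)"
    using int by (auto simp: has_bochner_integral_iff)
  have "I \<noteq> 0"
  proof
    assume "I = 0"
    then have "AE \<theta> in lborel. (h \<theta>)\<^sup>2 * p \<theta> = 0"
      using integral_nonneg_eq_0_iff_AE[OF I(2)] nonneg I(1) by simp
    then have "AE \<theta> in lborel. \<theta> \<notin> {c..c + 1}"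
      by (rule eventually_mono) (use h p in \<open>auto simp: less_imp_neq[symmetric]\<close>)
    then have "emeasure lborel {c..c + 1} = 0"
      by (subst (asm) AE_iff_measurable[of "{c..c + 1}"]) auto
    then show False by (simp only: emeasure_lborel_Icc_eq) simp
  qed
  moreover have "0 \<le> I"
    unfolding I(1) using nonneg by (rule Bochner_Integration.integral_nonneg)
  ultimately show ?thesis by simp
qed

lemma variance_of_log_inv_gamma_density_gt:
  assumes a: "a > 0" and b: "b > 0"
  shows "1 / a < variance_of (log_inv_gamma_density a b)"
proof -
  define p where "p = log_inv_gamma_density a b"
  define m where "m = mean_of p"
  note norm = has_bochner_integral_log_inv_gamma_density[OF a b, folded p_def]
  note mom = log_inv_gamma_moments(1-4)[OF a b, folded p_def, folded m_def]
  define Q where "Q = (\<integral>\<theta>. \<theta>\<^sup>2 * p \<theta> \<partial>lborel)"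
  have Q: "has_bochner_integral lborel (\<lambda>\<theta>. \<theta>\<^sup>2 * p \<theta>) Q"
    unfolding Q_def p_def
    by (intro has_bochner_integral_integrable integrable_power_log_inv_gamma_density a b)
  have "has_bochner_integral lborel (\<lambda>\<theta>. \<theta>\<^sup>2 * p \<theta> - 2 * m * (\<theta> * p \<theta>) + m\<^sup>2 * p \<theta>)
      (Q - 2 * m * m + m\<^sup>2 * 1)"
    by (intro has_bochner_integral_add has_bochner_integral_diff has_bochner_integral_mult_right
        Q mom norm)
  also have "(\<lambda>\<theta>. \<theta>\<^sup>2 * p \<theta> - 2 * m * (\<theta> * p \<theta>) + m\<^sup>2 * p \<theta>) = (\<lambda>\<theta>. (\<theta> - m)\<^sup>2 * p \<theta>)"
    by (rule ext) (simp add: power2_diff algebra_simps)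
  finally have "variance_of p = Q - 2 * m * m + m\<^sup>2"
    using variance_of_log_inv_gamma_density[OF a b]
    by (simp add: has_bochner_integral_iff p_def m_def)
  then have var: "variance_of p = Q - m\<^sup>2" by (simp add: power2_eq_square)
  \<comment> \<open>With the score \<open>s = - a + b * exp (- \<theta>)\<close>, the function
    \<open>\<theta> - m + s / a\<close> is \<open>?h\<close>. Since \<open>s\<close> has second
    moment \<open>a\<close> and \<open>\<theta> * s\<close> has mean \<open>- 1\<close>, the second
    moment of \<open>?h\<close> is the variance minus \<open>1 / a\<close>.\<close>
  define c where "c = b / a"
  define k where "k = m + 1"
  let ?h = "\<lambda>\<theta>. \<theta> - k + c * exp (- \<theta>)"
  have "has_bochner_integral lborel
      (\<lambda>\<theta>. \<theta>\<^sup>2 * p \<theta> - 2 * k * (\<theta> * p \<theta>) + k\<^sup>2 * p \<theta> + 2 * c * (\<theta> * (exp (- \<theta>) * p \<theta>))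
         - 2 * c * k * (exp (- \<theta>) * p \<theta>) + c\<^sup>2 * ((exp (- \<theta>))\<^sup>2 * p \<theta>))
      (Q - 2 * k * m + k\<^sup>2 * 1 + 2 * c * ((a * m - 1) / b)
         - 2 * c * k * (a / b) + c\<^sup>2 * (a * (a + 1) / b\<^sup>2))" (is "has_bochner_integral _ ?f ?I")
    by (intro has_bochner_integral_add has_bochner_integral_diff has_bochner_integral_mult_right
        Q mom norm)
  also have "?f = (\<lambda>\<theta>. (?h \<theta>)\<^sup>2 * p \<theta>)"
    by (rule ext) (simp add: power2_eq_square algebra_simps)
  also have "?I = Q - m\<^sup>2 - 1 / a"
    using a b by (simp add: c_def k_def power2_eq_square field_simps)
  finally have "has_bochner_integral lborel (\<lambda>\<theta>. (?h \<theta>)\<^sup>2 * p \<theta>) (Q - m\<^sup>2 - 1 / a)" .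
  then have "0 < Q - m\<^sup>2 - 1 / a"
    unfolding p_def
  proof (rule integral_log_inv_gamma_pos[OF a b])
    fix \<theta> assume "\<theta> \<ge> k"
    then have "?h \<theta> > 0" using a b by (simp add: c_def add_nonneg_pos)
    then show "?h \<theta> \<noteq> 0" by simp
  qed
  then show ?thesis using var by (simp add: p_def)
qed

text \<open>Jensen's inequality for \<open>exp\<close>, proved by integrating the tangent line bound
  at \<open>c - \<theta>\<close>: the mean of \<open>exp (c - \<theta>)\<close> is 1 for
  \<open>c = ln (b / a)\<close>.\<close>

lemma mean_of_log_inv_gamma_density_ge:
  assumes a: "a > 0" and b: "b > 0"
  shows "ln (b / a) \<le> mean_of (log_inv_gamma_density a b)"
proof -
  define p where "p = log_inv_gamma_density a b"
  define c where "c = ln (b / a)"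
  note norm = has_bochner_integral_log_inv_gamma_density[OF a b, folded p_def]
  note mom = log_inv_gamma_moments(1-4)[OF a b, folded p_def]
  have ec: "exp c = b / a" using a b by (simp add: c_def)
  have "has_bochner_integral lborel
     (\<lambda>\<theta>. exp c * (exp (- \<theta>) * p \<theta>) - (1 + c) * p \<theta> + \<theta> * p \<theta>)
     (exp c * (a / b) - (1 + c) * 1 + mean_of p)"
    by (intro has_bochner_integral_add has_bochner_integral_diff has_bochner_integral_mult_right
        mom norm)
  then have "(\<integral>\<theta>. exp c * (exp (- \<theta>) * p \<theta>) - (1 + c) * p \<theta> + \<theta> * p \<theta> \<partial>lborel) = mean_of p - c"
    using a b by (simp add: has_bochner_integral_iff ec)
  moreover have "0 \<le> (\<integral>\<theta>. exp c * (exp (- \<theta>) * p \<theta>) - (1 + c) * p \<theta> + \<theta> * p \<theta> \<partial>lborel)"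
  proof (rule Bochner_Integration.integral_nonneg)
    fix \<theta>
    have "0 \<le> (exp (c - \<theta>) - (1 + (c - \<theta>))) * p \<theta>"
      using log_inv_gamma_density_pos[OF a b, of \<theta>] exp_ge_add_one_self[of "c - \<theta>"]
      unfolding p_def by (intro mult_nonneg_nonneg) linarith+
    then show "0 \<le> exp c * (exp (- \<theta>) * p \<theta>) - (1 + c) * p \<theta> + \<theta> * p \<theta>"
      by (simp add: exp_diff exp_minus field_simps)
  qed
  ultimately show ?thesis by (simp add: p_def c_def)
qed

lemma mean_of_log_inv_gamma_density_gt:
  assumes a: "a > 0" and b: "b > 0"
  shows "ln (b / a) + 1 / (2 * a) < mean_of (log_inv_gamma_density a b)"
proof -
  define f where "f s = mean_of (log_inv_gamma_density s b) - ln b + ln s - 1 / (2 * s)" for s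
  have step: "f (s + 1) < f s" if "s > 0" for s
  proof -
    \<comment> \<open>The trapezoidal rule overestimates the integral of the convex function
      \<open>1 / x\<close> over \<open>[s, s + 1]\<close>.\<close>
    have "2 * ln (1 + 1 / s) < (1 + 1 / s) - inverse (1 + 1 / s)"
      using that by (intro less_ln_half_sum_inverse) auto
    also have "\<dots> = 1 / s + 1 / (s + 1)"
      using that by (simp add: field_simps)
    also have "1 + 1 / s = (s + 1) / s"
      using that by (simp add: field_simps)
    also have "ln ((s + 1) / s) = ln (s + 1) - ln s"
      using that by (simp add: ln_div)
    finally have less: "2 * (ln (s + 1) - ln s) < 1 / s + 1 / (s + 1)" .
    have diff: "f s - f (s + 1) = 1 / s - (ln (s + 1) - ln s) - 1 / s / 2 + 1 / (s + 1) / 2"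
      using log_inv_gamma_moments(5)[OF that b] by (simp add: f_def)
    have "0 < d" if "2 * l < x + y" "d = x - l - x / 2 + y / 2" for d l x y :: real
      using that by simp
    from this[OF less diff] show ?thesis by simp
  qed
  \<comment> \<open>The sequence starts at \<open>a + 1\<close>: the limit yields only
    \<open>0 \<le> f (a + 1)\<close>, and one strict step back to \<open>a\<close> makes the bound
    strict.\<close>
  have dec: "f (a + 1 + real n) \<le> f (a + 1)" for n
  proof (induction n)
    case (Suc n)
    have "f (a + 1 + real n + 1) < f (a + 1 + real n)" using a by (intro step) auto
    with Suc show ?case by (simp add: add.assoc add.commute)
  qed simp
  have "- 1 / (2 * (a + 1 + real n)) \<le> f (a + 1)" for n
  proof -
    have "- 1 / (2 * (a + 1 + real n)) \<le> f (a + 1 + real n)"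
      using mean_of_log_inv_gamma_density_ge[of "a + 1 + real n" b] a b
      by (simp add: f_def ln_div)
    with dec[of n] show ?thesis by linarith
  qed
  moreover have "(\<lambda>n. - 1 / (2 * (a + 1 + real n))) \<longlonglongrightarrow> 0"
    by real_asymp
  ultimately have "0 \<le> f (a + 1)"
    by (intro LIMSEQ_le_const2) auto
  with step[OF a] show ?thesis using a b by (simp add: f_def ln_div)
qed

lemma is_arg_max_log_inv_gamma_density:
  assumes a: "a > 0" and b: "b > 0"
    and "is_arg_max (log_inv_gamma_density a b) (\<lambda>_. True) m"
  shows "m = ln (b / a)"
proof -
  have le: "log_inv_gamma_density a b x \<le> log_inv_gamma_density a b m" for x
    using assms(3) by (auto simp: is_arg_max_def not_less)
  define K where "K = b powr a / Gamma a"
  have "K > 0" using a b by (simp add: K_def Gamma_real_pos)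
  have "log_inv_gamma_density a b = (\<lambda>\<theta>. K * exp (- a * \<theta> - b * exp (- \<theta>)))"
    unfolding K_def by (rule ext) (rule log_inv_gamma_density_eq)
  then have "(log_inv_gamma_density a b has_real_derivative
      K * (exp (- a * m - b * exp (- m)) * (- a + b * exp (- m)))) (at m)"
    by (auto intro!: derivative_eq_intros simp: algebra_simps)
  from DERIV_local_max[OF this zero_less_one] le
  have "b * exp (- m) = a"
    using \<open>K > 0\<close> by simp
  then have "exp m = b / a" using a by (simp add: exp_minus field_simps)
  then show ?thesis by (metis ln_exp)
qed

section \<open>Comparison of the stationary points\<close>

lemma Fisher_var_bounds:
  fixes a v :: real
  assumes a: "a \<ge> 0.51" and v: "0 < v" "v < 2" and eq: "v * (a + 1) = exp (v / 2)"
  shows "v < 1.3" "v < 1 / a"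
proof -
  show "v < 1.3"
  proof (rule ccontr)
    assume "\<not> v < 1.3"
    then have v13: "1.3 \<le> v" by simp
    \<comment> \<open>The line \<open>1.51 * v\<close> lies above the chord of
      \<open>exp (v / 2)\<close> at both ends of \<open>[1.3, 2]\<close>: 1.963 against at most
      1.9565, and 3.02 against at most 3.\<close>
    have "1.51 * v \<le> (a + 1) * v" using a v by (intro mult_right_mono) auto
    then have "1.51 * v \<le> exp (v / 2)" using eq by (simp add: mult.commute)
    moreover have "0.35 * exp (v / 2) \<le> (1 - v / 2) * exp 0.65 + (v / 2 - 0.65) * exp 1"
      using exp_le_chord[of "0.65" "v/2" 1] v13 v by simp
    moreover have "(1 - v / 2) * exp 0.65 \<le> (1 - v / 2) * 1.9565"
      using exp_le_quadratic[of "0.65"] v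
      by (intro mult_left_mono) (auto simp: power2_eq_square)
    moreover have "(v / 2 - 0.65) * exp 1 \<le> (v / 2 - 0.65) * 3"
      using exp_one_less_3 v13 by (intro mult_left_mono) auto
    ultimately show False using v13 v by simp
  qed
  have "v * a < 1"
    using exp_half_less[OF v] eq by (simp add: algebra_simps)
  then show "v < 1 / a" using a by (simp add: field_simps)
qed

text \<open>In terms of \<open>D = v * a\<close> and \<open>E = exp (v / 2) = D + v\<close>, the
  claim reads \<open>v + ln D < v / (2 * D)\<close>. By \<open>ln D \<le> D - 1\<close> it follows
  from the polynomial inequality \<open>v < 2 * E * (1 + v - E)\<close>.\<close>

lemma Fisher_mean_less_KL_mean:
  fixes a v :: real
  assumes a: "a \<ge> 0.51" and v: "0 < v" "v < 2" and eq: "v * (a + 1) = exp (v / 2)"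
  shows "3 / 2 * v < ln ((a + 1) / a) + 1 / (2 * a)"
proof -
  define x where "x = v / 2"
  define E where "E = exp x"
  define D where "D = v * a"
  have x: "0 < x" "x < 0.65"
    using v Fisher_var_bounds[OF assms] by (auto simp: x_def)
  have D: "D = E - v" "0 < D" "D < 1"
    using a v eq Fisher_var_bounds(2)[OF assms]
    by (auto simp: D_def E_def x_def algebra_simps pos_less_divide_eq)
  have E1: "1 + x < E" using exp_minus_greater[of "-x"] x by (simp add: E_def)
  have E2: "E \<le> 1 + x + 0.725 * x\<^sup>2"
    using exp_le_quadratic[of x] x by (simp add: E_def)
  define Q where "Q = 1 + x + 0.725 * x\<^sup>2"
  \<comment> \<open>The quadratic \<open>z * (1 + v - z)\<close> decreases for \<open>z\<close>
    beyond \<open>(1 + v) / 2\<close>, so \<open>E\<close> may be replaced by its upper bound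
    \<open>Q\<close>.\<close>
  have "E * (1 + v - E) - Q * (1 + v - Q) = (Q - E) * (Q + E - (1 + v))"
    by (simp add: algebra_simps)
  also have "\<dots> \<ge> 0"
    using E1 E2 by (intro mult_nonneg_nonneg) (auto simp: Q_def x_def)
  finally have "Q * (1 + v - Q) \<le> E * (1 + v - E)" by simp
  moreover have "x < Q * (1 + v - Q)"
  proof -
    have "x\<^sup>2 < 0.4225"
      using power_strict_mono[OF x(2), of 2] x by (simp add: power2_eq_square)
    then have "0 < x\<^sup>2 * (0.275 - 0.525625 * x\<^sup>2)"
      using x by (intro mult_pos_pos) auto
    also have "\<dots> = Q * (1 + v - Q) - x"
      by (simp add: Q_def x_def power2_eq_square field_simps)
    finally show ?thesis by simp
  qed
  ultimately have "v < 2 * E * (1 + v - E)" by (simp add: x_def)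
  then have main: "v * (2 * D - 1) < 2 * D * (1 - D)"
    by (simp add: D(1) algebra_simps)
  have "ln D \<le> D - 1" using D by (intro ln_le_minus_one)
  then have "2 * D * ln D \<le> 2 * D * (D - 1)" using D by (intro mult_left_mono) auto
  moreover have "v * (2 * D - 1) = 2 * D * v - v" "2 * D * (1 - D) = - (2 * D * (D - 1))"
    by (simp_all add: algebra_simps)
  ultimately have "2 * D * v + 2 * D * ln D < v" using main by linarith
  then have "v + ln D < v / (2 * D)"
    using D(2,3) by (simp add: field_simps)
  also have "v / (2 * D) = 1 / (2 * a)" using v by (simp add: D_def)
  finally have "v + ln D < 1 / (2 * a)" .
  moreover have "(a + 1) / a = E / D"
    using v a eq by (simp add: D_def E_def x_def field_simps)
  then have "ln ((a + 1) / a) = x - ln D"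
    using D by (simp add: ln_div E_def)
  ultimately show ?thesis by (simp add: x_def)
qed

lemma one_minus_mult_exp_antimono:
  fixes v w :: real
  assumes "v \<le> w" "w \<le> 1"
  shows "(1 - w) * exp (- w) \<le> (1 - v) * exp (- v)"
  using assms by (intro mult_mono) auto

text \<open>If \<open>v \<le> u\<close>, monotonicity of \<open>(1 - u) * exp (- u)\<close> and the
  Fisher equation bound the square of \<open>v * a\<close> by \<open>1 - v\<close>. But
  \<open>v * a = exp (v / 2) - v\<close> is at least \<open>1 - v / 2\<close>, whose square exceeds
  \<open>1 - v\<close>.\<close>

lemma Score_var_less_Fisher_var:
  fixes a u v :: real
  assumes a: "a > 0" and v: "0 < v" "v < 2" and eq: "v * (a + 1) = exp (v / 2)"
    and u: "(a + 1)\<^sup>2 * ((1 - u) * exp (- u)) = a\<^sup>2"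
  shows "u < v"
proof (rule ccontr)
  assume "\<not> u < v"
  then have "v \<le> u" by simp
  have "0 < (a + 1)\<^sup>2 * ((1 - u) * exp (- u))" using u a by simp
  then have "u < 1" using a by (simp add: zero_less_mult_iff)
  define E where "E = exp (v / 2)"
  have E2: "E * E = exp v" by (simp add: E_def flip: exp_add)
  have Ea: "E = v * a + v" using eq by (simp add: E_def algebra_simps)
  have "0 < (v / 2)\<^sup>2" using v by simp
  then have "1 - v < (1 - v / 2)\<^sup>2" by (simp add: power2_eq_square algebra_simps)
  also have "\<dots> \<le> (E - v)\<^sup>2"
  proof (rule power_mono)
    have "1 + v / 2 \<le> E" unfolding E_def by (rule exp_ge_add_one_self)
    then show "1 - v / 2 \<le> E - v" by simp
  qed (use v in auto)
  also have "\<dots> = v\<^sup>2 * a\<^sup>2" by (simp add: Ea power_mult_distrib)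
  also have "\<dots> = v\<^sup>2 * (a + 1)\<^sup>2 * ((1 - u) * exp (- u))" using u by simp
  also have "\<dots> \<le> v\<^sup>2 * (a + 1)\<^sup>2 * ((1 - v) * exp (- v))"
    using \<open>v \<le> u\<close> \<open>u < 1\<close> by (intro mult_left_mono one_minus_mult_exp_antimono) auto
  also have "v\<^sup>2 * (a + 1)\<^sup>2 = exp v"
    using eq E2 by (simp add: E_def power2_eq_square) (metis mult.assoc mult.commute)
  also have "exp v * ((1 - v) * exp (- v)) = 1 - v"
    by (simp add: exp_minus field_simps)
  finally show False by simp
qed

lemma mode_less_Score_mean:
  fixes a u :: real
  assumes a: "a \<ge> 0.51"
    and u: "(a + 1)\<^sup>2 * ((1 - u) * exp (- u)) = a\<^sup>2"
  shows "ln ((a + 1) / a) < 3 / 2 * u"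
proof (rule ccontr)
  assume *: "\<not> ?thesis"
  \<comment> \<open>At this value of \<open>u\<close> the claim would be an equality. The right-hand
    side of the score equation, divided by the square of \<open>a + 1\<close>, is
    \<open>exp (- 3 * w)\<close>, so a contradiction follows from
    \<open>exp (- (2 * w)) < 1 - w\<close>.\<close>
  define w where "w = 2 / 3 * ln ((a + 1) / a)"
  have "u \<le> w" using * by (simp add: w_def)
  have "(a + 1) / a \<le> 1.51 / 0.51" using a by (simp add: field_simps)
  also have "\<dots> < exp 1.125"
    using exp_lower_cubic[of "1.125"] by (simp add: power2_eq_square power3_eq_cube)
  finally have "exp (ln ((a + 1) / a)) < exp 1.125" using a by simp
  then have "ln ((a + 1) / a) < 1.125" by (simp only: exp_less_cancel_iff)
  then have w: "0 < w" "w < 0.75" using a by (auto simp: w_def)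
  \<comment> \<open>On \<open>[-1.5, 0]\<close> the chord of \<open>exp\<close> at
    \<open>- 2 * w\<close> lies below \<open>1 - w\<close> because
    \<open>exp (-1.5) < 1 / 4\<close>; this is why \<open>w < 0.75\<close> is secured first.\<close>
  have "0.75 * exp (- (2 * w)) \<le> (0.75 - w) * 1 + w * exp (-1.5)"
    using exp_le_chord[of "-1.5" "- 2 * w" 0] w by simp
  moreover have "exp (-1.5 :: real) < 1 / 4"
    using exp_lower_cubic[of "1.5"] by (simp add: exp_minus power2_eq_square power3_eq_cube field_simps)
  then have "w * exp (-1.5) < w * (1 / 4)" using w by (intro mult_strict_left_mono)
  ultimately have "exp (- (2 * w)) < 1 - w" by simp
  then have "exp (- (2 * w)) * exp (- w) < (1 - w) * exp (- w)" by simp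
  also have "\<dots> \<le> (1 - u) * exp (- u)"
    using \<open>u \<le> w\<close> w by (intro one_minus_mult_exp_antimono) auto
  also have "\<dots> = (a / (a + 1))\<^sup>2"
    using u a by (simp add: power_divide eq_divide_eq mult.commute)
  also have "exp (- (2 * w)) * exp (- w) = exp (- ln ((a + 1) / a)) ^ 2"
    by (simp add: w_def power2_eq_square flip: exp_add)
  also have "exp (- ln ((a + 1) / a)) = a / (a + 1)"
    using a by (simp add: exp_minus)
  finally show False by simp
qed

theorem theorem3:
  fixes n :: nat and y :: "nat \<Rightarrow> real"
    and a0 b0 a1 b1 :: real and p :: "real \<Rightarrow> real"
    and \<mu>_KL v_KL \<mu>_F v_F \<mu>_S v_S m_star :: real
  assumes "n \<ge> 1"
    and "a0 = 0.01" and "b0 = 0.01"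
    and "a1 = a0 + real n / 2"
    and "b1 = b0 + 1 / 2 * (\<Sum>i = 1..n. (y i)\<^sup>2)"
    and "p = log_inv_gamma_density a1 b1"
    and "optimal_params (KL_obj p) (\<mu>_KL, v_KL)"
    and "optimal_params (Fisher_obj p) (\<mu>_F, v_F)"
    and "optimal_params (Score_obj p) (\<mu>_S, v_S)"
    and "is_arg_max p (\<lambda>_. True) m_star"
  shows "(v_S < v_F \<and> v_F < v_KL \<and> v_KL < variance_of p) \<and>
         (m_star < \<mu>_S \<and> \<mu>_S < \<mu>_F \<and> \<mu>_F < \<mu>_KL \<and> \<mu>_KL < mean_of p)"
proof -
  \<comment> \<open>The value \<open>0.51\<close> is the shape for a single observation,
    \<open>n = 1\<close>.\<close>
  have a: "a1 \<ge> 0.51" and a': "a1 > 0"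
    using assms(1,2,4) by auto
  have b: "b1 > 0"
    using assms(3,5) sum_nonneg[of "{1..n}" "\<lambda>i. (y i)\<^sup>2"] by simp
  note p = assms(6)
  note KL = KL_optimal[OF a' b assms(7)[unfolded p]]
  note F = Fisher_optimal[OF a' b assms(8)[unfolded p]]
  note S = Score_optimal[OF a' b assms(9)[unfolded p]]
  note vF = optimal_params_pos[OF assms(8)]
  have m: "m_star = ln (b1 / a1)"
    using is_arg_max_log_inv_gamma_density[OF a' b] assms(10) p by simp
  have SF: "v_S < v_F"
    by (rule Score_var_less_Fisher_var[OF a' vF F(3,2) S(2)])
  have FKL: "v_F < v_KL"
    using Fisher_var_bounds(2)[OF a vF F(3,2)] KL(1) by simp
  have KLp: "v_KL < variance_of p"
    using variance_of_log_inv_gamma_density_gt[OF a' b] KL(1) p by simp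
  have "m_star < \<mu>_S"
    using mode_less_Score_mean[OF a S(2)] a' b by (simp add: m S(1) ln_div)
  \<comment> \<open>Both means lie on the same line, increasing in the variance.\<close>
  moreover have "\<mu>_S < \<mu>_F"
    using SF by (simp add: S(1) F(1))
  moreover have "\<mu>_F < \<mu>_KL"
    using Fisher_mean_less_KL_mean[OF a vF F(3,2)] a' b by (simp add: F(1) KL(2) ln_div)
  moreover have "\<mu>_KL < mean_of p"
    using mean_of_log_inv_gamma_density_gt[OF a' b] KL(2) p by simp
  ultimately show ?thesis
    using SF FKL KLp by blast
qed

end
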